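(* Let $(S,\to,\twoheadrightarrow,\hookrightarrow)$ be a finite two-acyclic factorization system. If $X\subseteq S$ is a closed set, then the canonical join representation of $X$ (in the lattice of closed sets) is $\{T(c): c\in\operatorname{Cov}(X)\}$.
   Context: For a binary relation $\to$ on a set $S$ and $X\subseteq S$, put $X^\perp=\{y\in S: x\not\to y\ \forall x\in X\}$ and ${}^\perp X=\{y\in S: y\not\to x\ \forall x\in X\}$. The closure of $X$ is $\overline X={}^\perp(X^\perp)$; $X$ is closed if $\overline X=X$. The closed sets, ordered by containment, form a complete lattice (isomorphic, via $X\mapsto(X,X^\perp)$, to the lattice $\operatorname{Pairs}(\to)$ of pairs $(X,Y)$ with $Y=X^\perp$, $X={}^\perp Y$ ordered by containment of first components). For a reflexive relation $\to$ on $S$, $\operatorname{Fact}(\to)=(\twoheadrightarrow,\hookrightarrow)$, where $x\twoheadrightarrow y$ iff for all $z$, $y\to z$ implies $x\to z$, and $x\hookrightarrow y$ iff for all $z$, $z\to x$ implies $z\to y$. For preorders $\twoheadrightarrow,\hookrightarrow$ on $S$, $\operatorname{Mult}(\twoheadrightarrow,\hookrightarrow)$ is the relation relating $x$ to $z$ iff there is $y\in S$ with $x\twoheadrightarrow y\hookrightarrow z$. A factorization system is a tuple $(S,\to,\twoheadrightarrow,\hookrightarrow)$ with $\to$ reflexive, $\operatorname{Fact}(\to)=(\twoheadrightarrow,\hookrightarrow)$ and $\operatorname{Mult}(\twoheadrightarrow,\hookrightarrow)=\to$; it is finite if $S$ is finite. It is two-acyclic if $x\twoheadrightarrow y\twoheadrightarrow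 x$ implies $x=y$, $x\hookrightarrow y\hookrightarrow x$ implies $x=y$, and $x\twoheadrightarrow y\hookrightarrow x$ implies $x=y$. For $c\in S$, $T(c)=\{x'\in S: c\twoheadrightarrow x'\}$, which is a closed set. For $c\in X$, $\operatorname{Del}(X,c)=X\setminus\{x\in X: x\twoheadrightarrow c\}$. For a closed set $X$, $\operatorname{Cov}(X)$ is the set of $c\in X$ such that $\operatorname{Del}(X,c)$ is closed and $\overline{\operatorname{Del}(X,c)\cup\{c\}}=X$. For subsets $A,A'$ of a lattice $L$, write $A\le\!\!\!\le A'$ if for every $a\in A$ there is $a'\in A'$ with $a\le a'$. A subset $A\subseteq L$ is the canonical join representation of $x\in L$ if $x=\bigvee A$, $A\le\!\!\!\le A'$ for every $A'\subseteq L$ with $x=\bigvee A'$, and $A$ is an antichain; an element has at most one canonical join representation. *)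

theory Defs
  imports "HOL-Algebra.Complete_Lattice"
begin

section \<open>Closed sets of a binary relation\<close>

text \<open>A relation on \<open>S\<close> is a set of pairs \<open>R \<subseteq> S \<times> S\<close>; \<open>(x, y) \<in> R\<close> is read \<open>x \<rightarrow> y\<close>.\<close>

definition right_perp :: "'a set \<Rightarrow> 'a rel \<Rightarrow> 'a set \<Rightarrow> 'a set" where
  "right_perp S R X = {y \<in> S. \<forall>x\<in>X. (x, y) \<notin> R}"

definition left_perp :: "'a set \<Rightarrow> 'a rel \<Rightarrow> 'a set \<Rightarrow> 'a set" where
  "left_perp S R X = {y \<in> S. \<forall>x\<in>X. (y, x) \<notin> R}"

definition perp_closure :: "'a set \<Rightarrow> 'a rel \<Rightarrow> 'a set \<Rightarrow> 'a set" where
  "perp_closure S R X = left_perp S R (right_perp S R X)"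

definition perp_closed :: "'a set \<Rightarrow> 'a rel \<Rightarrow> 'a set \<Rightarrow> bool" where
  "perp_closed S R X \<longleftrightarrow> X \<subseteq> S \<and> perp_closure S R X = X"

definition closed_sets_lattice :: "'a set \<Rightarrow> 'a rel \<Rightarrow> 'a set gorder" where
  "closed_sets_lattice S R = \<lparr>carrier = {X. perp_closed S R X}, eq = (=), le = (\<subseteq>)\<rparr>"

lemma perp_closure_mono: "X \<subseteq> Y \<Longrightarrow> perp_closure S R X \<subseteq> perp_closure S R Y"
  by (auto simp: perp_closure_def left_perp_def right_perp_def)

lemma perp_closure_extensive: "X \<subseteq> S \<Longrightarrow> X \<subseteq> perp_closure S R X"
  by (auto simp: perp_closure_def left_perp_def right_perp_def)

lemma perp_closure_closed: "X \<subseteq> S \<Longrightarrow> perp_closed S R (perp_closure S R X)"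
  by (auto simp: perp_closed_def perp_closure_def left_perp_def right_perp_def)

lemma complete_lattice_closed_sets: "complete_lattice (closed_sets_lattice S R)"
proof -
  let ?L = "closed_sets_lattice S R"
  interpret partial_order ?L
    by unfold_locales (auto simp: closed_sets_lattice_def)
  have carr: "X \<in> carrier ?L \<longleftrightarrow> perp_closed S R X" for X
    by (simp add: closed_sets_lattice_def)
  have le: "X \<sqsubseteq>\<^bsub>?L\<^esub> Y \<longleftrightarrow> X \<subseteq> Y" for X Y
    by (simp add: closed_sets_lattice_def)
  show ?thesis
  proof
    fix A assume A: "A \<subseteq> carrier ?L"
    have clA: "\<And>X. X \<in> A \<Longrightarrow> perp_closed S R X"
      using A by (auto simp: closed_sets_lattice_def)
    then have sub: "\<And>X. X \<in> A \<Longrightarrow> X \<subseteq> S"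
      by (auto simp: perp_closed_def)
    have fix_cl: "\<And>X. perp_closed S R X \<Longrightarrow> perp_closure S R X = X"
      by (simp add: perp_closed_def)
    show "\<exists>s. least ?L s (Upper ?L A)"
    proof (intro exI least_UpperI)
      let ?s = "perp_closure S R (\<Union>A)"
      have US: "\<Union>A \<subseteq> S" using sub by blast
      show "?s \<in> carrier ?L" unfolding carr by (rule perp_closure_closed[OF US])
      show "A \<subseteq> carrier ?L" by (fact A)
      show "X \<sqsubseteq>\<^bsub>?L\<^esub> ?s" if "X \<in> A" for X
        unfolding le using perp_closure_extensive[OF US, of R] that by blast
      show "?s \<sqsubseteq>\<^bsub>?L\<^esub> Y" if "Y \<in> Upper ?L A" for Y
      proof -
        have "\<Union>A \<subseteq> Y" "perp_closed S R Y"
          using that clA by (auto simp: Upper_def closed_sets_lattice_def)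
        then show ?thesis
          unfolding le using perp_closure_mono[of "\<Union>A" Y S R] fix_cl[of Y] by simp
      qed
    qed
    show "\<exists>i. greatest ?L i (Lower ?L A)"
    proof (intro exI greatest_LowerI)
      let ?i = "S \<inter> \<Inter>A"
      have "perp_closure S R ?i \<subseteq> X" if "X \<in> A" for X
        using perp_closure_mono[of ?i X S R] that A carr fix_cl[of X] by auto
      moreover have "perp_closure S R ?i \<subseteq> S"
        by (auto simp: perp_closure_def left_perp_def)
      ultimately have "perp_closure S R ?i = ?i"
        using perp_closure_extensive[of ?i S R] by blast
      then show "?i \<in> carrier ?L" unfolding carr by (simp add: perp_closed_def)
      show "A \<subseteq> carrier ?L" by (fact A)
      show "?i \<sqsubseteq>\<^bsub>?L\<^esub> X" if "X \<in> A" for X unfolding le using that by blast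
      show "Y \<sqsubseteq>\<^bsub>?L\<^esub> ?i" if "Y \<in> Lower ?L A" for Y
      proof -
        have "Y \<subseteq> S" "\<forall>X\<in>A. Y \<subseteq> X"
          using that clA unfolding Lower_def closed_sets_lattice_def perp_closed_def
          by simp_all
        then show ?thesis unfolding le by blast
      qed
    qed
  qed
qed

section \<open>Factorization systems\<close>

definition Fact :: "'a set \<Rightarrow> 'a rel \<Rightarrow> 'a rel \<times> 'a rel" where
  "Fact S R =
     ({(x, y). x \<in> S \<and> y \<in> S \<and> (\<forall>z\<in>S. (y, z) \<in> R \<longrightarrow> (x, z) \<in> R)},
      {(x, y). x \<in> S \<and> y \<in> S \<and> (\<forall>z\<in>S. (z, x) \<in> R \<longrightarrow> (z, y) \<in> R)})"

definition Mult :: "'a set \<Rightarrow> 'a rel \<Rightarrow> 'a rel \<Rightarrow> 'a rel" where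
  "Mult S P I = {(x, z). x \<in> S \<and> z \<in> S \<and> (\<exists>y\<in>S. (x, y) \<in> P \<and> (y, z) \<in> I)}"

text \<open>In the tuple \<open>(S, R, P, I)\<close>, \<open>P\<close> is the relation written with a two-headed arrow and
  \<open>I\<close> the one written with a hooked arrow.\<close>

definition factorization_system :: "'a set \<Rightarrow> 'a rel \<Rightarrow> 'a rel \<Rightarrow> 'a rel \<Rightarrow> bool" where
  "factorization_system S R P I \<longleftrightarrow>
     R \<subseteq> S \<times> S \<and> refl_on S R \<and> Fact S R = (P, I) \<and> Mult S P I = R"

definition two_acyclic :: "'a rel \<Rightarrow> 'a rel \<Rightarrow> bool" where
  "two_acyclic P I \<longleftrightarrow>
     (\<forall>x y. (x, y) \<in> P \<and> (y, x) \<in> P \<longrightarrow> x = y) \<and>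
     (\<forall>x y. (x, y) \<in> I \<and> (y, x) \<in> I \<longrightarrow> x = y) \<and>
     (\<forall>x y. (x, y) \<in> P \<and> (y, x) \<in> I \<longrightarrow> x = y)"

definition T :: "'a set \<Rightarrow> 'a rel \<Rightarrow> 'a \<Rightarrow> 'a set" where
  "T S P c = {x \<in> S. (c, x) \<in> P}"

definition Del :: "'a rel \<Rightarrow> 'a set \<Rightarrow> 'a \<Rightarrow> 'a set" where
  "Del P X c = X - {x \<in> X. (x, c) \<in> P}"

definition Cov :: "'a set \<Rightarrow> 'a rel \<Rightarrow> 'a rel \<Rightarrow> 'a set \<Rightarrow> 'a set" where
  "Cov S R P X =
     {c \<in> X. perp_closed S R (Del P X c) \<and> perp_closure S R (Del P X c \<union> {c}) = X}"

section \<open>Canonical join representations\<close>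

definition join_refines :: "('a, 'b) gorder_scheme \<Rightarrow> 'a set \<Rightarrow> 'a set \<Rightarrow> bool" where
  "join_refines L A A' \<longleftrightarrow> (\<forall>a\<in>A. \<exists>a'\<in>A'. a \<sqsubseteq>\<^bsub>L\<^esub> a')"

text \<open>``\<open>x\<close> is the join of \<open>A\<close>'' is rendered as \<open>least L x (Upper L A)\<close> rather than
  \<open>x = \<Squnion>\<^bsub>L\<^esub> A\<close>, since \<open>\<Squnion>\<^bsub>L\<^esub> A\<close> is an arbitrary value when no join exists.\<close>

definition canonical_join_rep :: "('a, 'b) gorder_scheme \<Rightarrow> 'a \<Rightarrow> 'a set \<Rightarrow> bool" where
  "canonical_join_rep L x A \<longleftrightarrow>
     A \<subseteq> carrier L \<and>
     least L x (Upper L A) \<and>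
     (\<forall>A'. A' \<subseteq> carrier L \<and> least L x (Upper L A') \<longrightarrow> join_refines L A A') \<and>
     (\<forall>a\<in>A. \<forall>b\<in>A. a \<sqsubseteq>\<^bsub>L\<^esub> b \<longrightarrow> a = b)"

lemma canonical_join_rep_unique:
  assumes "partial_order L" and A: "canonical_join_rep L x A" and B: "canonical_join_rep L x B"
  shows "A = B"
proof -
  interpret partial_order L by fact
  have *: "a \<in> B" if cA: "canonical_join_rep L x A" and cB: "canonical_join_rep L x B" and aA: "a \<in> A" for a A B
  proof -
    have AB: "A \<subseteq> carrier L" "B \<subseteq> carrier L" "join_refines L A B" "join_refines L B A"
      using cA cB by (auto simp: canonical_join_rep_def)
    obtain b where b: "b \<in> B" "a \<sqsubseteq>\<^bsub>L\<^esub> b"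
      using AB(3) aA by (auto simp: join_refines_def)
    obtain a' where a': "a' \<in> A" "b \<sqsubseteq>\<^bsub>L\<^esub> a'"
      using AB(4) b(1) by (auto simp: join_refines_def)
    have mem: "a \<in> carrier L" "b \<in> carrier L" "a' \<in> carrier L"
      using AB aA b(1) a'(1) by auto
    have "a \<sqsubseteq>\<^bsub>L\<^esub> a'" using le_trans[OF b(2) a'(2)] mem by simp
    then have "a = a'"
      using cA aA a'(1) by (auto simp: canonical_join_rep_def)
    then show ?thesis using b a' mem le_antisym by metis
  qed
  show ?thesis using *[OF A B] *[OF B A] by blast
qed

end

theory Submission
  imports Defs
begin

(* If c is in Cov X, then Del X c is a closed proper subset of X, so every family of closed sets
   with join X has a member containing some x that maps onto c, hence containing c. It remains to
   see that Cov X generates X. Otherwise Cov X lies in a maximal proper closed subset Z of X. For c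
   minimal in X - Z with respect to P, one finds Z = Del X c, so that c is in Cov X but not in Z. *)

lemma perp_closure_least:
  assumes "perp_closed S R Y" "A \<subseteq> Y"
  shows "perp_closure S R A \<subseteq> Y"
  using perp_closure_mono[OF assms(2)] assms(1) unfolding perp_closed_def by metis

text \<open>\<open>X\<close> consists of the elements of \<open>S\<close> related to nothing in its
  right perp, and \<open>(x, y) \<in> P\<close> means that \<open>y\<close> is related to nothing
  that \<open>x\<close> is not.\<close>

lemma perp_closed_up:
  assumes "Fact S R = (P, I)" "perp_closed S R X" "x \<in> X" "(x, y) \<in> P"
  shows "y \<in> X"
proof -
  have P: "y \<in> S" "\<And>z. z \<in> S \<Longrightarrow> (y, z) \<in> R \<Longrightarrow> (x, z) \<in> R"
    using assms(1,4) by (auto simp: Fact_def)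
  have X: "X = left_perp S R (right_perp S R X)"
    using assms(2) by (simp add: perp_closed_def perp_closure_def)
  have "y \<in> left_perp S R (right_perp S R X)"
    using P \<open>x \<in> X\<close> by (auto simp: left_perp_def right_perp_def)
  then show ?thesis using X by blast
qed

text \<open>The dual of \<open>perp_closed_up\<close>: whatever is related to \<open>x\<close> is
  related to \<open>y\<close>. \<open>X\<close> lies in \<open>S\<close> because the quantifier in
  \<open>Fact\<close> ranges over \<open>S\<close>.\<close>

lemma right_perp_down:
  assumes "Fact S R = (P, I)" "y \<in> right_perp S R X" "(x, y) \<in> I" "X \<subseteq> S"
  shows "x \<in> right_perp S R X"
  using assms by (auto simp: Fact_def right_perp_def)

lemma Fact_refl:
  assumes "Fact S R = (P, I)" "x \<in> S"
  shows "(x, x) \<in> P"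
  using assms by (auto simp: Fact_def)

lemma Fact_trans:
  assumes "Fact S R = (P, I)"
  shows "trans P"
  using assms by (auto simp: Fact_def trans_def)

text \<open>Unfolded, \<open>x\<close> lies in the closure of \<open>{c}\<close> iff
  \<open>c\<close> is related to everything that \<open>x\<close> is related to, which is the
  definition of \<open>P\<close> in \<open>Fact\<close>.\<close>

lemma T_eq_closure:
  assumes "Fact S R = (P, I)" "c \<in> S"
  shows "T S P c = perp_closure S R {c}"
  using assms by (auto simp: T_def Fact_def perp_closure_def left_perp_def right_perp_def)

lemma perp_closed_T:
  assumes "Fact S R = (P, I)" "c \<in> S"
  shows "perp_closed S R (T S P c)"
  using perp_closure_closed[of "{c}" S R] assms by (simp add: T_eq_closure)

lemma T_subset_iff:
  assumes "Fact S R = (P, I)" "perp_closed S R X" "c \<in> S"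
  shows "T S P c \<subseteq> X \<longleftrightarrow> c \<in> X"
  using perp_closed_up[OF assms(1,2)] Fact_refl[OF assms(1,3)] assms(3) by (auto simp: T_def)

text \<open>Since \<open>Z\<close> is a left perp, \<open>x\<close> is related to some
  \<open>z\<close> in the right perp of \<open>Z\<close>. The middle element of a factorization of
  this relation stays in the right perp.\<close>

lemma not_mem_perp_closedE:
  assumes fs: "factorization_system S R P I" and Z: "perp_closed S R Z" and x: "x \<in> S" "x \<notin> Z"
  obtains w where "w \<in> right_perp S R Z" "(x, w) \<in> P"
proof -
  have F: "Fact S R = (P, I)" and M: "Mult S P I = R"
    using fs by (auto simp: factorization_system_def)
  have "Z \<subseteq> S" "Z = left_perp S R (right_perp S R Z)"
    using Z by (auto simp: perp_closed_def perp_closure_def)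
  then obtain z where z: "z \<in> right_perp S R Z" "(x, z) \<in> R"
    using x by (auto simp: left_perp_def)
  then obtain w where "(x, w) \<in> P" "(w, z) \<in> I"
    using M by (auto simp: Mult_def)
  then show ?thesis
    using that right_perp_down[OF F z(1)] \<open>Z \<subseteq> S\<close> by blast
qed

lemma right_perp_disjoint:
  assumes "refl_on S R" "x \<in> right_perp S R Z"
  shows "x \<notin> Z"
  using assms by (auto simp: right_perp_def refl_on_def)

text \<open>By maximality every element of \<open>X - Z\<close> generates \<open>X\<close> over
  \<open>Z\<close>, hence is related to all of \<open>X\<close> in the right perp of
  \<open>Z\<close>. Factoring these relations forces all of \<open>X - Z\<close> to map by
  \<open>P\<close> to one element \<open>c\<close>.\<close>

lemma maximal_proper_closed_eq_Del:
  assumes fs: "factorization_system S R P I" and "finite S" and "two_acyclic P I"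
    and X: "perp_closed S R X" and Z: "perp_closed S R Z" and "Z \<subset> X"
    and max: "\<And>Y. perp_closed S R Y \<Longrightarrow> Z \<subset> Y \<Longrightarrow> Y \<subseteq> X \<Longrightarrow> Y = X"
  obtains c where "c \<in> X - Z" "Z = Del P X c" "perp_closure S R (Z \<union> {c}) = X"
proof -
  have F: "Fact S R = (P, I)" and M: "Mult S P I = R" and refl: "refl_on S R"
    using fs by (auto simp: factorization_system_def)
  have antiP: "antisym P" and antiI: "antisym I"
    using \<open>two_acyclic P I\<close> by (auto simp: two_acyclic_def antisym_def)
  have sub: "X \<subseteq> S" "Z \<subseteq> S" using X Z by (auto simp: perp_closed_def)
  have up: "y \<in> X" if "x \<in> X" "(x, y) \<in> P" for x y using perp_closed_up[OF F X that] .
  have join: "perp_closure S R (Z \<union> {x}) = X" if "x \<in> X - Z" for x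
  proof (rule max)
    have "Z \<union> {x} \<subseteq> S" using that sub by auto
    then show "perp_closed S R (perp_closure S R (Z \<union> {x}))" "Z \<subset> perp_closure S R (Z \<union> {x})"
      using perp_closure_closed perp_closure_extensive[of "Z \<union> {x}" S R] that by blast+
    show "perp_closure S R (Z \<union> {x}) \<subseteq> X"
      using perp_closure_least[OF X] that \<open>Z \<subset> X\<close> by simp
  qed
  (* If x does not map to y, then y lies in the right perp of Z and x, that is, of X. *)
  have rel: "(x, y) \<in> R" if "x \<in> X - Z" "y \<in> X" "y \<in> right_perp S R Z" for x y
  proof (rule ccontr)
    assume "(x, y) \<notin> R"
    then have "y \<in> right_perp S R (Z \<union> {x})" using that by (auto simp: right_perp_def)
    moreover have "y \<in> left_perp S R (right_perp S R (Z \<union> {x}))"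
      using join[OF that(1)] that(2) by (simp add: perp_closure_def)
    moreover have "(y, y) \<in> R" using refl sub that by (auto simp: refl_on_def)
    ultimately show False by (auto simp: left_perp_def)
  qed
  \<comment> \<open>The middle element \<open>v\<close> lies in \<open>X\<close> because
    \<open>X\<close> is closed upward under \<open>P\<close>, and outside \<open>Z\<close> because
    reflexivity makes \<open>Z\<close> disjoint from its right perp.\<close>
  have fact: "\<exists>v. (x, v) \<in> P \<and> (v, y) \<in> I \<and> v \<in> X - Z \<and> v \<in> right_perp S R Z"
    if xy: "x \<in> X - Z" "y \<in> X" "y \<in> right_perp S R Z" for x y
  proof -
    obtain v where v: "(x, v) \<in> P" "(v, y) \<in> I"
      using rel[OF xy] M by (auto simp: Mult_def)
    have "v \<in> right_perp S R Z" using right_perp_down[OF F xy(3) v(2) sub(2)] .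
    then show ?thesis using v up xy right_perp_disjoint[OF refl] by blast
  qed
  \<comment> \<open>The converse is taken so that a minimal element is one with no proper
    \<open>P\<close>-successor.\<close>
  have wf: "wf ((P - Id)\<inverse> \<inter> S \<times> S)"
  proof (rule finite_acyclic_wf)
    show "finite ((P - Id)\<inverse> \<inter> S \<times> S)" using \<open>finite S\<close> by blast
    have "trans (P - Id)" by (intro trans_diff_Id Fact_trans[OF F] antiP)
    then have "acyclic ((P - Id)\<inverse>)" by (simp add: acyclic_def)
    then show "acyclic ((P - Id)\<inverse> \<inter> S \<times> S)"
      by (rule acyclic_subset) (rule Int_lower1)
  qed
  obtain c where c: "c \<in> X - Z" and min: "\<And>y. (c, y) \<in> P \<Longrightarrow> y \<in> X - Z \<Longrightarrow> y = c"
  proof -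
    obtain x where "x \<in> X - Z" using \<open>Z \<subset> X\<close> by blast
    then obtain c where "c \<in> X - Z" "\<And>y. (y, c) \<in> (P - Id)\<inverse> \<inter> S \<times> S \<Longrightarrow> y \<notin> X - Z"
      using wfE_min[OF wf] by metis
    then show ?thesis using that[of c] sub by blast
  qed
  have c_perp: "c \<in> right_perp S R Z"
  proof -
    obtain w where w: "w \<in> right_perp S R Z" "(c, w) \<in> P"
      using not_mem_perp_closedE[OF fs Z] c sub by blast
    \<comment> \<open>\<open>w\<close> is a \<open>P\<close>-successor of \<open>c\<close> in
      \<open>X - Z\<close>, so minimality gives \<open>w = c\<close>.\<close>
    then show ?thesis using min up c right_perp_disjoint[OF refl] by blast
  qed
  have "(x, c) \<in> P" if x: "x \<in> X - Z" for x
  proof -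
    obtain y where y: "(x, y) \<in> P" "(y, c) \<in> I" "y \<in> X - Z" "y \<in> right_perp S R Z"
      using fact[OF x _ c_perp] c by blast
    \<comment> \<open>The relation from \<open>c\<close> back to \<open>y\<close> is factored too.
      Minimality turns \<open>v\<close> into \<open>c\<close>, so \<open>c\<close> and
      \<open>y\<close> are related by \<open>I\<close> in both directions and coincide.\<close>
    then obtain v where "(c, v) \<in> P" "(v, y) \<in> I" "v \<in> X - Z"
      using fact[OF c] by blast
    then have "(c, y) \<in> I" using min by blast
    then have "y = c" using y(2) antiI by (auto dest: antisymD)
    then show ?thesis using y(1) by simp
  qed
  moreover have "x \<notin> Z" if "(x, c) \<in> P" for x
    using perp_closed_up[OF F Z _ that] c by blast
  ultimately have "Z = Del P X c"
    using \<open>Z \<subset> X\<close> by (auto simp: Del_def)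
  then show ?thesis using that c join[OF c] by blast
qed

lemma perp_closure_Cov:
  assumes fs: "factorization_system S R P I" and fin: "finite S" and ac: "two_acyclic P I"
    and X: "perp_closed S R X"
  shows "perp_closure S R (Cov S R P X) = X"
proof (rule ccontr)
  let ?C = "Cov S R P X"
  assume "perp_closure S R ?C \<noteq> X"
  have "X \<subseteq> S" using X by (simp add: perp_closed_def)
  have C: "?C \<subseteq> X" by (auto simp: Cov_def)
  have clC: "perp_closed S R (perp_closure S R ?C)" "?C \<subseteq> perp_closure S R ?C"
    using C \<open>X \<subseteq> S\<close> by (auto intro!: perp_closure_closed perp_closure_extensive[THEN subsetD])
  define F where "F = {Z. perp_closed S R Z \<and> ?C \<subseteq> Z \<and> Z \<subset> X}"
  have "finite F"
    by (rule finite_subset[of _ "Pow S"]) (use fin \<open>X \<subseteq> S\<close> in \<open>auto simp: F_def\<close>)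
  moreover have "perp_closure S R ?C \<in> F"
    using clC perp_closure_least[OF X C] \<open>perp_closure S R ?C \<noteq> X\<close> by (auto simp: F_def)
  ultimately obtain Z where ZF: "Z \<in> F" and max: "\<forall>Y\<in>F. Z \<subseteq> Y \<longrightarrow> Z = Y"
    using finite_has_maximal[of F] by blast
  have Z: "perp_closed S R Z" "?C \<subseteq> Z" "Z \<subset> X" using ZF by (auto simp: F_def)
  \<comment> \<open>A closed set above \<open>Z\<close> still contains \<open>?C\<close>, so
    maximality within \<open>F\<close> is maximality among all proper closed subsets of
    \<open>X\<close>.\<close>
  have "Y = X" if "perp_closed S R Y" "Z \<subset> Y" "Y \<subseteq> X" for Y
  proof (rule ccontr)
    assume "Y \<noteq> X"
    then have "Y \<in> F" using that Z(2) by (auto simp: F_def)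
    then show False using max that(2) by blast
  qed
  then obtain c where c: "c \<in> X - Z" "Z = Del P X c" "perp_closure S R (Z \<union> {c}) = X"
    using maximal_proper_closed_eq_Del[OF fs fin ac X Z(1,3)] by metis
  then have "c \<in> ?C" using Z(1) by (simp add: Cov_def)
  then show False using c(1) Z(2) by blast
qed

lemma Cov_not_in_Del:
  assumes "Fact S R = (P, I)" "perp_closed S R X" "c \<in> Cov S R P X"
  shows "perp_closed S R (Del P X c)" "\<not> X \<subseteq> Del P X c"
proof -
  show "perp_closed S R (Del P X c)" using assms(3) by (simp add: Cov_def)
  have "c \<in> X" "c \<in> S" using assms(2,3) by (auto simp: Cov_def perp_closed_def)
  then show "\<not> X \<subseteq> Del P X c" using Fact_refl[OF assms(1)] by (auto simp: Del_def)
qed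

text \<open>If \<open>d \<noteq> c\<close>, then \<open>c\<close> survives in
  \<open>Del P X d\<close>, and whatever maps to \<open>d\<close> also maps to \<open>c\<close>. So
  the closed set \<open>Del P X d\<close> contains generators of \<open>X\<close>, although it omits
  \<open>d\<close>.\<close>

lemma Cov_antichain:
  assumes F: "Fact S R = (P, I)" and "antisym P" and X: "perp_closed S R X"
    and c: "c \<in> Cov S R P X" and d: "d \<in> Cov S R P X" and dc: "(d, c) \<in> P"
  shows "d = c"
proof (rule ccontr)
  assume "d \<noteq> c"
  then have "(c, d) \<notin> P" using dc \<open>antisym P\<close> by (auto dest: antisymD)
  moreover have "c \<in> X" using c by (simp add: Cov_def)
  moreover have "(x, c) \<in> P" if "(x, d) \<in> P" for x
    using transD[OF Fact_trans[OF F] that dc] .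
  ultimately have "Del P X c \<union> {c} \<subseteq> Del P X d"
    by (auto simp: Del_def)
  then have "perp_closure S R (Del P X c \<union> {c}) \<subseteq> Del P X d"
    by (rule perp_closure_least[OF Cov_not_in_Del(1)[OF F X d]])
  then have "X \<subseteq> Del P X d" using c by (simp add: Cov_def)
  then show False using Cov_not_in_Del(2)[OF F X d] by blast
qed

text \<open>Upper bounds of \<open>A\<close> are the closed supersets of its union, which turns
  joins into plain set inclusions.\<close>

lemma least_Upper_closed_sets_iff:
  assumes "A \<subseteq> carrier (closed_sets_lattice S R)" "perp_closed S R X"
  shows "least (closed_sets_lattice S R) X (Upper (closed_sets_lattice S R) A) \<longleftrightarrow>
    \<Union>A \<subseteq> X \<and> (\<forall>Y. perp_closed S R Y \<and> \<Union>A \<subseteq> Y \<longrightarrow> X \<subseteq> Y)"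
proof -
  have "Upper (closed_sets_lattice S R) A = {Y. perp_closed S R Y \<and> \<Union>A \<subseteq> Y}"
    using assms(1) by (auto simp: Upper_def closed_sets_lattice_def)
  then show ?thesis
    using assms(2) by (auto simp: least_def closed_sets_lattice_def)
qed

theorem theorem5p10:
  fixes S :: "'a set" and R P I :: "'a rel" and X :: "'a set"
  assumes "factorization_system S R P I"
    and "finite S"
    and "two_acyclic P I"
    and "perp_closed S R X"
  shows "canonical_join_rep (closed_sets_lattice S R) X {T S P c | c. c \<in> Cov S R P X}"
proof -
  let ?L = "closed_sets_lattice S R" and ?C = "Cov S R P X"
  let ?A = "{T S P c | c. c \<in> ?C}"
  note X = \<open>perp_closed S R X\<close>
  have F: "Fact S R = (P, I)" using assms(1) by (auto simp: factorization_system_def)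
  have anti: "antisym P" using assms(3) by (auto simp: two_acyclic_def antisym_def)
  have C: "?C \<subseteq> X" "X \<subseteq> S" using X by (auto simp: Cov_def perp_closed_def)
  have A: "?A \<subseteq> carrier ?L"
    using perp_closed_T[OF F] C by (auto simp: closed_sets_lattice_def)
  \<comment> \<open>The upper bounds of \<open>?A\<close> are thus the closed supersets of
    \<open>?C\<close>, and the join is the closure of \<open>?C\<close>.\<close>
  have union: "\<Union>?A \<subseteq> Y \<longleftrightarrow> ?C \<subseteq> Y" if "perp_closed S R Y" for Y
  proof -
    have "\<Union>?A \<subseteq> Y \<longleftrightarrow> (\<forall>c\<in>?C. T S P c \<subseteq> Y)" by blast
    also have "\<dots> \<longleftrightarrow> ?C \<subseteq> Y" using T_subset_iff[OF F that] C by blast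
    finally show ?thesis .
  qed
  have lub: "least ?L X (Upper ?L ?A)"
    unfolding least_Upper_closed_sets_iff[OF A X]
  proof (intro conjI allI impI)
    show "\<Union>?A \<subseteq> X" by (rule iffD2[OF union[OF X] C(1)])
    show "X \<subseteq> Y" if Y: "perp_closed S R Y \<and> \<Union>?A \<subseteq> Y" for Y
    proof -
      have "?C \<subseteq> Y" by (rule iffD1[OF union conjunct2[OF Y]]) (rule conjunct1[OF Y])
      then have "perp_closure S R ?C \<subseteq> Y" by (rule perp_closure_least[OF conjunct1[OF Y]])
      then show ?thesis by (simp only: perp_closure_Cov[OF assms])
    qed
  qed
  have refines: "join_refines ?L ?A A'"
    if A': "A' \<subseteq> carrier ?L" "least ?L X (Upper ?L A')" for A'
  proof -
    have join: "\<Union>A' \<subseteq> X" "\<And>Y. perp_closed S R Y \<Longrightarrow> \<Union>A' \<subseteq> Y \<Longrightarrow> X \<subseteq> Y"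
      using A' least_Upper_closed_sets_iff[OF A'(1) X] by auto
    have "\<exists>a\<in>A'. T S P c \<subseteq> a" if c: "c \<in> ?C" for c
    proof -
      have "\<not> \<Union>A' \<subseteq> Del P X c"
        using join(2) Cov_not_in_Del[OF F X c] by blast
      \<comment> \<open>An element of the union that lies in \<open>X\<close> but not in
        \<open>Del P X c\<close> must map to \<open>c\<close>.\<close>
      then obtain a x where a: "a \<in> A'" "x \<in> a" "(x, c) \<in> P"
        using join(1) by (auto simp: Del_def)
      have "perp_closed S R a" using a(1) A'(1) by (auto simp: closed_sets_lattice_def)
      then have "T S P c \<subseteq> a"
        using perp_closed_up[OF F _ a(2,3)] T_subset_iff[OF F] c C by blast
      then show ?thesis using a(1) by blast
    qed
    then show ?thesis by (auto simp: join_refines_def closed_sets_lattice_def)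
  qed
  have antichain: "a = b" if ab: "a \<in> ?A" "b \<in> ?A" "a \<subseteq> b" for a b
  proof -
    obtain c d where cd: "a = T S P c" "b = T S P d" "c \<in> ?C" "d \<in> ?C"
      using ab by blast
    \<comment> \<open>\<open>T\<close> reverses the order: inclusion of \<open>T S P c\<close> in
      \<open>T S P d\<close> gives \<open>(d, c) \<in> P\<close>.\<close>
    then have "c \<in> T S P d" using ab(3) Fact_refl[OF F] C by (auto simp: T_def)
    then have "d = c" using Cov_antichain[OF F anti X cd(3,4)] by (simp add: T_def)
    then show ?thesis using cd by simp
  qed
  have le: "a \<sqsubseteq>\<^bsub>?L\<^esub> b \<longleftrightarrow> a \<subseteq> b" for a b
    by (simp add: closed_sets_lattice_def)
  show ?thesis
    unfolding canonical_join_rep_def le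
    by (intro conjI allI ballI impI A lub; (elim conjE)?; rule refines antichain; assumption)
qed

end
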